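(* Let $k\geq 1$ be an integer. For every finite set $I$ of intervals, the greedy algorithm for sets of intervals (described in the context) computes the $k$-width of $I$; that is, it outputs a partition of $I$ into $k$-ary chains whose number of classes equals $k\text{-wd}(I)$.
   Context: Intervals are closed real intervals $[a,b]$ with $a<b$. The (strict) partial order on intervals is: $[a_1,b_1]$ is below $[a_2,b_2]$ if and only if $b_1\leq a_2$. The total order $\sqsubseteq$ on intervals is: $[a_1,b_1]\sqsubseteq[a_2,b_2]$ if $b_1<b_2$, or $b_1=b_2$ and $a_1<a_2$. A rooted tree is $k$-ary if every node has at most $k$ children. A set $A$ of intervals is a $k$-ary chain if there exist a $k$-ary rooted tree $T$ and a bijection between $A$ and the vertices of $T$ such that whenever $v$ is a (proper) descendant of $u$ in $T$, $u$ is below $v$. The $k$-width $k\text{-wd}(I)$ of a finite set $I$ of intervals is the smallest number of classes in a partition of $I$ into $k$-ary chains. Greedy algorithm for sets of intervals. Sort the intervals of $I$ with respect to $\sqsubseteq$ as $I_1,\ldots,I_n$. Maintain a forest of $k$-ary trees, initially empty (with no slots). Whenever an interval $[a,b]$ is placed in the forest, $k$ empty slots (its child positions), each of value $b$, are created. An empty slot of value $x$ is compatible with $[a,b]$ if $x\leq a$. For $i=1,\ldots,n$: if $I_i$ is compatible with some empty slot, insert $I_i$ into a compatible empty slot of highest value (as a child of the node owning that slot; the slot is then no longer empty); otherwise create a new tree rooted at $I_i$. The output is the partition of $I$ into the vertex sets of the trees. *)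

theory Defs
  imports Complex_Main "HOL-Library.Interval" "HOL-Library.Disjoint_Sets"
begin

text \<open>
  The library type of closed real intervals also contains the degenerate intervals \<open>[a,a]\<close>;
  the intervals considered here are the proper ones.
\<close>

definition proper_interval :: "real interval \<Rightarrow> bool" where
  "proper_interval x \<longleftrightarrow> lower x < upper x"

definition below :: "real interval \<Rightarrow> real interval \<Rightarrow> bool" where
  "below x y \<longleftrightarrow> upper x \<le> lower y"

text \<open>The strict version of the total order on intervals.\<close>

definition sq_less :: "real interval \<Rightarrow> real interval \<Rightarrow> bool" where
  "sq_less x y \<longleftrightarrow> upper x < upper y \<or> upper x = upper y \<and> lower x < lower y"


text \<open>
  A rooted tree is given by its vertex set \<open>V\<close>, its parent-to-child relation \<open>E\<close> and its root \<open>r\<close>;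
  the proper descendants of \<open>u\<close> are the \<open>v\<close> with \<open>(u, v) \<in> E\<^sup>+\<close>.
\<close>

definition rooted_tree :: "'v set \<Rightarrow> 'v rel \<Rightarrow> 'v \<Rightarrow> bool" where
  "rooted_tree V E r \<longleftrightarrow>
     r \<in> V \<and> E \<subseteq> V \<times> V \<and>
     (\<nexists>u. (u, r) \<in> E) \<and>
     (\<forall>v \<in> V - {r}. \<exists>!u. (u, v) \<in> E) \<and>
     (\<forall>v \<in> V. (r, v) \<in> E\<^sup>*)"

definition kary_tree :: "nat \<Rightarrow> 'v set \<Rightarrow> 'v rel \<Rightarrow> 'v \<Rightarrow> bool" where
  "kary_tree k V E r \<longleftrightarrow>
     rooted_tree V E r \<and> (\<forall>u \<in> V. finite (E `` {u}) \<and> card (E `` {u}) \<le> k)"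

text \<open>
  Taking the vertices of the tree from the type of intervals is no restriction: the vertex set is
  in bijection with \<open>A\<close>, so every such tree has a copy with vertices of this type.
\<close>

definition kary_chain :: "nat \<Rightarrow> real interval set \<Rightarrow> bool" where
  "kary_chain k A \<longleftrightarrow>
     (\<exists>(V :: real interval set) E r f.
        kary_tree k V E r \<and> bij_betw f A V \<and>
        (\<forall>x \<in> A. \<forall>y \<in> A. (f x, f y) \<in> E\<^sup>+ \<longrightarrow> below x y))"

definition kary_chain_partition ::
    "nat \<Rightarrow> real interval set \<Rightarrow> real interval set set \<Rightarrow> bool" where
  "kary_chain_partition k I P \<longleftrightarrow> partition_on I P \<and> (\<forall>A \<in> P. kary_chain k A)"

definition k_width :: "nat \<Rightarrow> real interval set \<Rightarrow> nat" where
  "k_width k I = (LEAST n. \<exists>P. kary_chain_partition k I P \<and> finite P \<and> card P = n)"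


text \<open>
  The state of the greedy algorithm is a forest with empty slots. A slot \<open>(u, j)\<close> is the \<open>j\<close>-th
  child position of the node \<open>u\<close>.
\<close>

type_synonym slot = "real interval \<times> nat"

record forest =
  roots :: "real interval set"
  edges :: "real interval rel"
  slots :: "slot set"

definition empty_forest :: forest where
  "empty_forest = \<lparr>roots = {}, edges = {}, slots = {}\<rparr>"

definition slot_value :: "slot \<Rightarrow> real" where
  "slot_value s = upper (fst s)"

definition compatible :: "slot \<Rightarrow> real interval \<Rightarrow> bool" where
  "compatible s x \<longleftrightarrow> slot_value s \<le> lower x"

definition new_slots :: "nat \<Rightarrow> real interval \<Rightarrow> slot set" where
  "new_slots k x = {x} \<times> {..<k}"

text \<open>
  Several compatible slots may have the highest value, so one step of the algorithm is a relation:
  every choice of such a slot is allowed.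
\<close>

inductive greedy_step :: "nat \<Rightarrow> real interval \<Rightarrow> forest \<Rightarrow> forest \<Rightarrow> bool"
  for k :: nat and x :: "real interval" and F :: forest where
  insert_slot:
    "s \<in> slots F \<Longrightarrow> compatible s x \<Longrightarrow>
     (\<forall>t \<in> slots F. compatible t x \<longrightarrow> slot_value t \<le> slot_value s) \<Longrightarrow>
     greedy_step k x F
       (F\<lparr>edges := insert (fst s, x) (edges F), slots := (slots F - {s}) \<union> new_slots k x\<rparr>)"
| new_tree:
    "(\<forall>t \<in> slots F. \<not> compatible t x) \<Longrightarrow>
     greedy_step k x F
       (F\<lparr>roots := insert x (roots F), slots := slots F \<union> new_slots k x\<rparr>)"

inductive greedy_run :: "nat \<Rightarrow> real interval list \<Rightarrow> forest \<Rightarrow> bool" for k :: nat where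
  start: "greedy_run k [] empty_forest"
| step: "greedy_run k xs F \<Longrightarrow> greedy_step k x F F' \<Longrightarrow> greedy_run k (xs @ [x]) F'"

definition tree_vertex_sets :: "forest \<Rightarrow> real interval set set" where
  "tree_vertex_sets F = (\<lambda>r. (edges F)\<^sup>* `` {r}) ` roots F"

definition greedy_output ::
    "nat \<Rightarrow> real interval set \<Rightarrow> real interval set set \<Rightarrow> bool" where
  "greedy_output k I P \<longleftrightarrow>
     (\<exists>xs F. set xs = I \<and> sorted_wrt sq_less xs \<and> greedy_run k xs F \<and> P = tree_vertex_sets F)"

end

theory Submission
  imports Defs
begin

text \<open>
  A partition into \<open>k\<close>-ary chains assigns to every non-root a parent below it, each parent serving
  at most \<open>k\<close> children. Hence for every real \<open>t\<close> it has at least \<open>|X| - k * |U|\<close> classes, where \<open>X\<close>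
  consists of the intervals with lower end at most \<open>t\<close> and \<open>U\<close> of those with upper end at most \<open>t\<close>.
  The greedy forest attains this bound for the greatest lower end \<open>t\<close> of an interval such that no
  empty slot has value at most \<open>t\<close>. Indeed all roots lie in \<open>X\<close>, and since slots of highest value are
  chosen, a child of an element of \<open>U\<close> lies in \<open>X\<close>; so \<open>X\<close> consists of the roots and the children
  of elements of \<open>U\<close>, and each element of \<open>U\<close> has exactly \<open>k\<close> children.
\<close>

section \<open>Preliminaries: the sorting order, and ancestors under unique parents\<close>

lemma linorder_sq_less: "class.linorder (\<lambda>x y. x = y \<or> sq_less x y) sq_less"
  by unfold_locales (auto simp: sq_less_def interval_eq_iff)

lemma ex_sq_less_sorted_list:
  assumes "finite I"
  shows "\<exists>xs. set xs = I \<and> sorted_wrt sq_less xs"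
  using linorder.finite_set_strict_sorted[OF linorder_sq_less assms] by metis

text \<open>When every vertex has at most one parent, the walk upwards from \<open>c\<close> is
  forced, so \<open>a\<close> and \<open>b\<close> both lie on a single path ending in
  \<open>c\<close>.\<close>

lemma rtrancl_comparable_if_single_valued_converse:
  assumes "single_valued (E\<inverse>)" and "(a, c) \<in> E\<^sup>*" and "(b, c) \<in> E\<^sup>*"
  shows "(a, b) \<in> E\<^sup>* \<or> (b, a) \<in> E\<^sup>*"
  using single_valued_confluent[OF assms(1), of c a b] assms(2,3)
  by (auto simp: rtrancl_converse)

section \<open>Lower bound on the number of classes of any partition into chains\<close>

lemma kary_chain_card_lower_le:
  assumes "kary_chain k A" and "finite A"
  shows "card {x \<in> A. lower x \<le> t} \<le> 1 + k * card {u \<in> A. upper u \<le> t}"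
proof -
  obtain V :: "real interval set" and E r f where tree: "kary_tree k V E r" and bij: "bij_betw f A V"
    and desc: "\<forall>x \<in> A. \<forall>y \<in> A. (f x, f y) \<in> E\<^sup>+ \<longrightarrow> below x y"
    using assms(1) unfolding kary_chain_def by blast
  let ?X = "{x \<in> A. lower x \<le> t}" and ?U = "{u \<in> A. upper u \<le> t}"
  have rooted: "rooted_tree V E r"
    and children: "\<And>u. u \<in> V \<Longrightarrow> finite (E `` {u}) \<and> card (E `` {u}) \<le> k"
    using tree by (auto simp: kary_tree_def)
  have image: "f ` A = V" and inj: "inj_on f A"
    using bij by (auto simp: bij_betw_def)
  \<comment> \<open>A non-root \<open>f x\<close> with \<open>x\<close> in \<open>?X\<close> has a
    parent \<open>f u\<close> with \<open>upper u \<le> lower x \<le> t\<close>, so \<open>u\<close>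
    lies in \<open>?U\<close>.\<close>
  have sub: "f ` ?X \<subseteq> insert r (\<Union>u\<in>?U. E `` {f u})"
  proof clarify
    fix x assume x: "x \<in> A" "lower x \<le> t" and notin: "f x \<notin> (\<Union>u\<in>?U. E `` {f u})"
    show "f x = r"
    proof (rule ccontr)
      assume "f x \<noteq> r"
      then obtain v where v: "(v, f x) \<in> E" "v \<in> V"
        using rooted x(1) image unfolding rooted_tree_def by blast
      then obtain u where u: "u \<in> A" "v = f u" using image by blast
      then have "below u x" using desc x(1) v(1) by blast
      then have "u \<in> ?U" using u(1) x(2) by (simp add: below_def)
      then show False using notin v(1) u(2) by blast
    qed
  qed
  have fin: "finite (\<Union>u\<in>?U. E `` {f u})"
    using assms(2) children image by auto
  have "card ?X = card (f ` ?X)"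
    by (rule card_image[symmetric]) (rule inj_on_subset[OF inj], auto)
  also have "\<dots> \<le> card (insert r (\<Union>u\<in>?U. E `` {f u}))"
    using sub fin by (intro card_mono) auto
  also have "\<dots> \<le> 1 + card (\<Union>u\<in>?U. E `` {f u})"
    using fin by (simp add: card_insert_if)
  also have "card (\<Union>u\<in>?U. E `` {f u}) \<le> (\<Sum>u\<in>?U. card (E `` {f u}))"
    using assms(2) by (intro card_UN_le) auto
  also have "\<dots> \<le> k * card ?U"
    using children image sum_bounded_above[of ?U "\<lambda>u. card (E `` {f u})" k]
    by (auto simp: mult.commute)
  finally show ?thesis by simp
qed

text \<open>Summing the bound for single chains over the classes: each class contributes 1 for its
  root, which gives \<open>card P\<close>, and the counts add up because the classes are disjoint
  and cover \<open>I\<close>.\<close>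

lemma kary_chain_partition_card_lower_le:
  assumes P: "kary_chain_partition k I P" and "finite I"
  shows "card {x \<in> I. lower x \<le> t} \<le> card P + k * card {u \<in> I. upper u \<le> t}"
proof -
  have part: "partition_on I P" and chain: "\<And>A. A \<in> P \<Longrightarrow> kary_chain k A"
    using P by (auto simp: kary_chain_partition_def)
  have fin: "finite P" "\<And>A. A \<in> P \<Longrightarrow> finite A"
    using finite_elements[OF \<open>finite I\<close> part] part \<open>finite I\<close>
    by (auto simp: partition_on_def intro: finite_subset)
  have disj: "A \<inter> B = {}" if "A \<in> P" "B \<in> P" "A \<noteq> B" for A B
    using part that by (auto simp: partition_on_def disjoint_def)
  have split: "card {x \<in> I. Q x} = (\<Sum>A\<in>P. card {x \<in> A. Q x})" for Q
  proof -
    have "{x \<in> I. Q x} = (\<Union>A\<in>P. {x \<in> A. Q x})"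
      using part by (auto simp: partition_on_def)
    moreover have "card (\<Union>A\<in>P. {x \<in> A. Q x}) = (\<Sum>A\<in>P. card {x \<in> A. Q x})"
      using fin disj by (intro card_UN_disjoint; simp; blast)
    ultimately show ?thesis by simp
  qed
  have "(\<Sum>A\<in>P. card {x \<in> A. lower x \<le> t}) \<le> (\<Sum>A\<in>P. 1 + k * card {u \<in> A. upper u \<le> t})"
    using kary_chain_card_lower_le chain fin(2) by (intro sum_mono) auto
  then show ?thesis
    by (simp add: split sum.distrib sum_distrib_left del: One_nat_def)
qed

section \<open>The invariant of the greedy algorithm and its preservation\<close>

text \<open>The state once exactly the intervals of \<open>A\<close> are placed. The last two
  assumptions record the greedy choices in terms of the slots that are empty now: none of them could
  have taken a root, and none that fits a child has a higher value than the slot the child took.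
  Every node has \<open>k\<close> positions, each holding a child or still empty.\<close>

locale greedy_forest =
  fixes k :: nat and A :: "real interval set" and F :: forest
  assumes finite_nodes: "finite A"
    and proper: "x \<in> A \<Longrightarrow> proper_interval x"
    and roots_subset: "roots F \<subseteq> A"
    and edges_subset: "edges F \<subseteq> A \<times> A"
    and slots_subset: "slots F \<subseteq> A \<times> {..<k}"
    and edge_below: "(u, v) \<in> edges F \<Longrightarrow> below u v"
    and root_or_child: "v \<in> A \<Longrightarrow> v \<in> roots F \<or> v \<in> Range (edges F)"
    and root_no_parent: "v \<in> roots F \<Longrightarrow> v \<notin> Range (edges F)"
    and parent_unique: "(u, v) \<in> edges F \<Longrightarrow> (u', v) \<in> edges F \<Longrightarrow> u = u'"
    and card_children_slots:
      "u \<in> A \<Longrightarrow> card (edges F `` {u}) + card (slots F `` {u}) = k"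
    and root_incompatible: "r \<in> roots F \<Longrightarrow> s \<in> slots F \<Longrightarrow> \<not> compatible s r"
    and edge_highest: "(u, v) \<in> edges F \<Longrightarrow> s \<in> slots F \<Longrightarrow> compatible s v \<Longrightarrow>
      slot_value s \<le> upper u"
begin

lemma finite_slots: "finite (slots F)"
  using slots_subset finite_nodes by (auto intro: finite_subset)

lemma finite_children: "finite (edges F `` {u})"
  by (rule finite_subset[OF _ finite_nodes]) (use edges_subset in auto)

lemma ex_greedy_step: "\<exists>F'. greedy_step k x F F'"
proof (cases "\<exists>s \<in> slots F. compatible s x")
  case False
  then show ?thesis using greedy_step.new_tree by blast
next
  case True
  let ?C = "{s \<in> slots F. compatible s x}"
  have "finite (slot_value ` ?C)" "slot_value ` ?C \<noteq> {}"
    using finite_slots True by auto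
  then have "Max (slot_value ` ?C) \<in> slot_value ` ?C"
    and "\<And>t. t \<in> ?C \<Longrightarrow> slot_value t \<le> Max (slot_value ` ?C)"
    by (rule Max_in) (use finite_slots in auto)
  then obtain s where "s \<in> ?C" "\<forall>t \<in> ?C. slot_value t \<le> slot_value s" by fastforce
  then show ?thesis using greedy_step.insert_slot[of s F x k] by blast
qed

lemma greedy_step_greedy_forest:
  assumes step: "greedy_step k x F F'" and new: "x \<notin> A" and "proper_interval x"
    and upper: "\<And>y. y \<in> A \<Longrightarrow> upper y \<le> upper x"
  shows "greedy_forest k (insert x A) F'"
proof -
  \<comment> \<open>A new slot has value \<open>upper x\<close>, which is at least
    \<open>upper v\<close> and hence exceeds \<open>lower v\<close> for every placed
    \<open>v\<close>, including \<open>x\<close>. So both records of greedy choices only concern old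
    slots.\<close>
  have new_incompatible: "\<not> compatible s v" if "s \<in> new_slots k x" "v \<in> insert x A" for s v
    using that upper[of v] proper[of v] \<open>proper_interval x\<close>
    by (auto simp: new_slots_def compatible_def slot_value_def proper_interval_def)
  have no_edge: "(u, x) \<notin> edges F" "(x, u) \<notin> edges F" for u
    using edges_subset new by auto
  have no_slot: "(x, j) \<notin> slots F" for j
    using slots_subset new by auto
  show ?thesis
    using step
  proof cases
    case (insert_slot s)
    have s: "fst s \<in> A" "fst s \<noteq> x"
      using insert_slot(2) slots_subset new by auto
    have children: "card (edges F' `` {u}) + card (slots F' `` {u}) = k" if "u \<in> insert x A" for u
    proof (cases "u = x")
      case True
      have "edges F' `` {x} = {}" "slots F' `` {x} = {..<k}"
        using s no_edge no_slot by (auto simp: insert_slot(1) new_slots_def)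
      then show ?thesis using True by simp
    next
      case False
      then have old: "card (edges F `` {u}) + card (slots F `` {u}) = k"
        using that card_children_slots by blast
      show ?thesis
      proof (cases "u = fst s")
        case True
        have "edges F' `` {u} = insert x (edges F `` {u})"
          using True by (auto simp: insert_slot(1))
        moreover have "x \<notin> edges F `` {u}" using no_edge by auto
        moreover have "slots F' `` {u} = slots F `` {u} - {snd s}"
          using True s by (auto simp: insert_slot(1) new_slots_def prod_eq_iff)
        moreover have "snd s \<in> slots F `` {u}" using insert_slot(2) True by auto
        moreover have "finite (slots F `` {u})" using finite_slots by (rule finite_Image)
        \<comment> \<open>Positivity is required because removing \<open>snd s\<close> lowers the
          number of slots by a truncated subtraction, which must balance the added child.\<close>
        then have "card (slots F `` {u}) > 0" using calculation by (auto simp: card_gt_0_iff)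
        ultimately show ?thesis using old finite_children by simp
      next
        case False
        have "edges F' `` {u} = edges F `` {u}" "slots F' `` {u} = slots F `` {u}"
          using False \<open>u \<noteq> x\<close> by (auto simp: insert_slot(1) new_slots_def)
        then show ?thesis using old by simp
      qed
    qed
    show ?thesis
    proof
      show "slots F' \<subseteq> insert x A \<times> {..<k}" "edges F' \<subseteq> insert x A \<times> insert x A"
        "roots F' \<subseteq> insert x A"
        using s slots_subset edges_subset roots_subset
        by (auto simp: insert_slot(1) new_slots_def)
      show "below u v" if "(u, v) \<in> edges F'" for u v
        using that edge_below insert_slot(3)
        by (auto simp: insert_slot(1) below_def compatible_def slot_value_def)
      show "v \<in> roots F' \<or> v \<in> Range (edges F')" if "v \<in> insert x A" for v
        using that root_or_child by (auto simp: insert_slot(1))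
      show "v \<notin> Range (edges F')" if "v \<in> roots F'" for v
        using that root_no_parent roots_subset new by (auto simp: insert_slot(1))
      show "u = u'" if "(u, v) \<in> edges F'" "(u', v) \<in> edges F'" for u u' v
        using that no_edge parent_unique by (auto simp: insert_slot(1))
      show "\<not> compatible q r" if "r \<in> roots F'" "q \<in> slots F'" for r q
      proof -
        have "r \<in> roots F" "q \<in> slots F \<union> new_slots k x"
          using that by (auto simp: insert_slot(1))
        then show ?thesis using root_incompatible new_incompatible roots_subset by blast
      qed
      show "slot_value q \<le> upper u" if "(u, v) \<in> edges F'" "q \<in> slots F'" "compatible q v" for u v q
      proof -
        have "v \<in> insert x A" using that(1) edges_subset by (auto simp: insert_slot(1))
        then have "q \<notin> new_slots k x" using that(3) new_incompatible by blast
        then have "q \<in> slots F" using that(2) by (auto simp: insert_slot(1))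
        \<comment> \<open>For the new edge this is the maximality of \<open>s\<close> among the
          compatible slots; for an old edge it is the invariant.\<close>
        then show ?thesis
          using that(1,3) edge_highest[of u v q] insert_slot(4)
          by (auto simp: insert_slot(1) slot_value_def)
      qed
    qed (use finite_nodes proper \<open>proper_interval x\<close> children in auto)
  next
    case new_tree
    have children: "card (edges F' `` {u}) + card (slots F' `` {u}) = k" if "u \<in> insert x A" for u
    proof (cases "u = x")
      case True
      have "edges F' `` {x} = {}" "slots F' `` {x} = {..<k}"
        using no_edge no_slot by (auto simp: new_tree(1) new_slots_def)
      then show ?thesis using True by simp
    next
      case False
      have "edges F' `` {u} = edges F `` {u}" "slots F' `` {u} = slots F `` {u}"
        using False by (auto simp: new_tree(1) new_slots_def)
      then show ?thesis using that False card_children_slots by simp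
    qed
    show ?thesis
    proof
      show "slots F' \<subseteq> insert x A \<times> {..<k}" "edges F' \<subseteq> insert x A \<times> insert x A"
        "roots F' \<subseteq> insert x A"
        using slots_subset edges_subset roots_subset by (auto simp: new_tree(1) new_slots_def)
      show "below u v" if "(u, v) \<in> edges F'" for u v
        using that edge_below by (auto simp: new_tree(1))
      show "v \<in> roots F' \<or> v \<in> Range (edges F')" if "v \<in> insert x A" for v
        using that root_or_child by (auto simp: new_tree(1))
      show "v \<notin> Range (edges F')" if "v \<in> roots F'" for v
        using that root_no_parent no_edge by (auto simp: new_tree(1))
      show "u = u'" if "(u, v) \<in> edges F'" "(u', v) \<in> edges F'" for u u' v
        using that parent_unique by (auto simp: new_tree(1))
      show "\<not> compatible q r" if "r \<in> roots F'" "q \<in> slots F'" for r q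
      proof -
        have "r \<in> insert x (roots F)" "q \<in> slots F \<union> new_slots k x"
          using that by (auto simp: new_tree(1))
        then show ?thesis
          using root_incompatible new_incompatible roots_subset new_tree(2) by blast
      qed
      show "slot_value q \<le> upper u" if "(u, v) \<in> edges F'" "q \<in> slots F'" "compatible q v" for u v q
      proof -
        have "v \<in> insert x A" using that(1) edges_subset by (auto simp: new_tree(1))
        then have "q \<notin> new_slots k x" using that(3) new_incompatible by blast
        then have "q \<in> slots F" using that(2) by (auto simp: new_tree(1))
        then show ?thesis using that edge_highest by (auto simp: new_tree(1))
      qed
    qed (use finite_nodes proper \<open>proper_interval x\<close> children in auto)
  qed
qed

section \<open>The trees of the forest form a partition into chains\<close>

lemma trancl_below:
  assumes "(u, v) \<in> (edges F)\<^sup>+"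
  shows "below u v"
  using assms
proof induction
  case (base y)
  then show ?case by (rule edge_below)
next
  case (step y z)
  then have "proper_interval y" "below y z"
    using proper edges_subset edge_below by auto
  then show ?case using step.IH by (simp add: below_def proper_interval_def)
qed

text \<open>A cycle would put a proper interval below itself. Hence the finite edge relation is
  well-founded, and climbing from parent to parent ends at a root.\<close>

lemma ex_root:
  assumes "v \<in> A"
  shows "\<exists>r \<in> roots F. (r, v) \<in> (edges F)\<^sup>*"
proof -
  have "acyclic (edges F)"
  proof (rule acyclicI, clarify)
    fix u assume "(u, u) \<in> (edges F)\<^sup>+"
    moreover from this have "u \<in> A"
      using edges_subset trancl_subset_Sigma by blast
    ultimately show False
      using trancl_below[of u u] proper[of u] by (simp add: below_def proper_interval_def)
  qed
  moreover have "finite (edges F)"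
    using edges_subset finite_nodes by (auto intro: finite_subset)
  ultimately have "wf (edges F)" by (rule finite_acyclic_wf[rotated])
  then show ?thesis using assms
  proof induction
    case (less v)
    then show ?case
      using root_or_child[of v] edges_subset by (blast intro: rtrancl_into_rtrancl)
  qed
qed

text \<open>Two roots with a common descendant are comparable, and a root has no parent, so they
  coincide. This makes the trees disjoint and their number equal to that of the roots.\<close>

lemma root_unique:
  assumes "r \<in> roots F" "r' \<in> roots F" "(r, v) \<in> (edges F)\<^sup>*" "(r', v) \<in> (edges F)\<^sup>*"
  shows "r = r'"
proof -
  have "single_valued ((edges F)\<inverse>)"
    using parent_unique by (auto simp: single_valued_def)
  then have "(r, r') \<in> (edges F)\<^sup>* \<or> (r', r) \<in> (edges F)\<^sup>*"
    using assms(3,4) by (rule rtrancl_comparable_if_single_valued_converse)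
  then show ?thesis
    using root_no_parent assms(1,2) by (metis RangeI rtranclE)
qed

lemma card_tree_vertex_sets: "card (tree_vertex_sets F) = card (roots F)"
  unfolding tree_vertex_sets_def
  by (rule card_image) (use root_unique in \<open>fastforce simp: inj_on_def\<close>)

lemma tree_kary_chain:
  assumes "r \<in> roots F"
  shows "kary_chain k ((edges F)\<^sup>* `` {r})"
proof -
  let ?V = "(edges F)\<^sup>* `` {r}"
  \<comment> \<open>A rooted tree must have its edges inside its vertex set. Since \<open>?V\<close>
    is closed under children, the restriction keeps all paths from \<open>r\<close>.\<close>
  let ?E = "edges F \<inter> ?V \<times> ?V"
  have "(r, v) \<in> ?E\<^sup>*" if "(r, v) \<in> (edges F)\<^sup>*" for v
    using that
  proof induction
    case (step y z)
    then have "(y, z) \<in> ?E" by (auto intro: rtrancl_into_rtrancl)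
    then show ?case using step.IH by (rule rtrancl_into_rtrancl[rotated])
  qed simp
  moreover have "\<exists>!u. (u, v) \<in> ?E" if "v \<in> ?V - {r}" for v
  proof -
    have "(r, v) \<in> (edges F)\<^sup>*" "v \<noteq> r" using that by auto
    then obtain u where "(r, u) \<in> (edges F)\<^sup>*" "(u, v) \<in> edges F"
      using rtranclD[of r v] tranclD2[of r v] by blast
    then have "(u, v) \<in> ?E" by (auto intro: rtrancl_into_rtrancl)
    then show ?thesis by (rule ex1I) (use parent_unique \<open>(u, v) \<in> ?E\<close> in auto)
  qed
  ultimately have "rooted_tree ?V ?E r"
    using root_no_parent[OF assms] by (auto simp: rooted_tree_def)
  moreover have "finite (?E `` {u}) \<and> card (?E `` {u}) \<le> k" if "u \<in> ?V" for u
  proof -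
    have "u \<in> A"
      using that assms roots_subset edges_subset by (auto elim: rtranclE)
    then have "card (edges F `` {u}) \<le> k" using card_children_slots[of u] by simp
    moreover have "?E `` {u} \<subseteq> edges F `` {u}" by auto
    ultimately show ?thesis
      using finite_children by (meson card_mono finite_subset le_trans)
  qed
  ultimately have "kary_tree k ?V ?E r" by (simp add: kary_tree_def)
  moreover have "below x y" if "(x, y) \<in> ?E\<^sup>+" for x y
    using that trancl_below trancl_mono[of _ ?E "edges F"] by blast
  ultimately show ?thesis
    unfolding kary_chain_def
    by (intro exI[of _ ?V] exI[of _ ?E] exI[of _ r] exI[of _ id]) auto
qed

lemma tree_vertex_sets_kary_chain_partition: "kary_chain_partition k A (tree_vertex_sets F)"
proof -
  have "\<Union> (tree_vertex_sets F) \<subseteq> A"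
    using roots_subset edges_subset by (auto simp: tree_vertex_sets_def elim: rtranclE)
  moreover have "A \<subseteq> \<Union> (tree_vertex_sets F)"
    using ex_root by (auto simp: tree_vertex_sets_def)
  moreover have "disjoint (tree_vertex_sets F)"
    unfolding disjoint_def tree_vertex_sets_def using root_unique by blast
  moreover have "{} \<notin> tree_vertex_sets F"
    by (auto simp: tree_vertex_sets_def)
  ultimately show ?thesis
    using tree_kary_chain
    by (auto simp: kary_chain_partition_def partition_on_def tree_vertex_sets_def)
qed

section \<open>Optimality: a threshold at which the lower bound is attained\<close>

lemma ex_tight_threshold:
  assumes "A \<noteq> {}"
  shows "\<exists>t. card {x \<in> A. lower x \<le> t} = card (roots F) + k * card {u \<in> A. upper u \<le> t}"
proof -
  \<comment> \<open>The nodes that fit no slot that is empty now. Every root is one of them, so for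
    nonempty \<open>A\<close> the maximum \<open>t\<close> exists.\<close>
  let ?full = "{v \<in> A. \<forall>s \<in> slots F. \<not> compatible s v}"
  define t where "t = Max (lower ` ?full)"
  have roots_full: "roots F \<subseteq> ?full"
    using roots_subset root_incompatible by auto
  moreover have "roots F \<noteq> {}" using ex_root assms by blast
  ultimately have "lower ` ?full \<noteq> {}" by blast
  moreover have fin: "finite (lower ` ?full)" using finite_nodes by simp
  ultimately have "t \<in> lower ` ?full" unfolding t_def by (rule Max_in[rotated])
  \<comment> \<open>\<open>t\<close> is itself the lower end of a node in \<open>?full\<close>, so a
    slot of value at most \<open>t\<close> would be compatible with that node.\<close>
  then have no_slot: "\<not> slot_value s \<le> t" if "s \<in> slots F" for s
    using that by (auto simp: compatible_def)
  have le_t: "lower v \<le> t" if "v \<in> ?full" for v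
    unfolding t_def using that fin by (intro Max_ge) auto
  let ?X = "{x \<in> A. lower x \<le> t}" and ?U = "{u \<in> A. upper u \<le> t}"
  \<comment> \<open>An empty slot compatible with \<open>v\<close> would have value at most
    \<open>upper u \<le> t\<close> by \<open>edge_highest\<close>, which \<open>no_slot\<close>
    excludes. So \<open>v\<close> is in \<open>?full\<close>, and \<open>t\<close> bounds its lower
    end.\<close>
  have child: "lower v \<le> t" if "(u, v) \<in> edges F" "upper u \<le> t" for u v
  proof (rule le_t)
    show "v \<in> ?full"
      using that edge_highest no_slot edges_subset by fastforce
  qed
  have "?X = roots F \<union> edges F `` ?U"
  proof
    show "?X \<subseteq> roots F \<union> edges F `` ?U"
    proof
      fix x assume x: "x \<in> ?X"
      show "x \<in> roots F \<union> edges F `` ?U"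
      proof (cases "x \<in> roots F")
        case False
        then obtain u where u: "(u, x) \<in> edges F" using root_or_child x by blast
        then have "u \<in> ?U" using edge_below[OF u] edges_subset x by (auto simp: below_def)
        then show ?thesis using u by blast
      qed simp
    qed
    show "roots F \<union> edges F `` ?U \<subseteq> ?X"
      using le_t roots_full child edges_subset by blast
  qed
  moreover have "roots F \<inter> edges F `` ?U = {}" using root_no_parent by blast
  moreover have "finite (edges F `` ?U)" "finite (roots F)"
    using edges_subset roots_subset finite_nodes by (auto intro: finite_subset[of _ A])
  ultimately have "card ?X = card (roots F) + card (edges F `` ?U)"
    by (simp add: card_Un_disjoint)
  also have "edges F `` ?U = (\<Union>u\<in>?U. edges F `` {u})" by blast
  also have "card \<dots> = (\<Sum>u\<in>?U. card (edges F `` {u}))"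
    using finite_nodes finite_children parent_unique by (intro card_UN_disjoint) auto
  also have "\<dots> = (\<Sum>u\<in>?U. k)"
  proof (rule sum.cong)
    fix u assume u: "u \<in> ?U"
    \<comment> \<open>An empty slot of \<open>u\<close> would have value
      \<open>upper u \<le> t\<close>; hence all \<open>k\<close> positions of \<open>u\<close> hold
      children.\<close>
    then have "slots F `` {u} = {}" using no_slot by (auto simp: slot_value_def)
    then show "card (edges F `` {u}) = k" using u card_children_slots[of u] by simp
  qed simp
  finally show ?thesis by (auto simp: mult.commute)
qed

text \<open>At the tight threshold the lower bound for \<open>P\<close> has the term
  \<open>k * card {u \<in> A. upper u \<le> t}\<close> on both sides, and cancelling it leaves the
  claim. Empty \<open>A\<close> is separate, as it provides no threshold.\<close>

lemma card_roots_le: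
  assumes "kary_chain_partition k A P"
  shows "card (roots F) \<le> card P"
proof (cases "A = {}")
  case True
  then show ?thesis using roots_subset by simp
next
  case False
  then obtain t
    where "card {x \<in> A. lower x \<le> t} = card (roots F) + k * card {u \<in> A. upper u \<le> t}"
    using ex_tight_threshold by blast
  then show ?thesis
    using kary_chain_partition_card_lower_le[OF assms finite_nodes, of t] by simp
qed

lemma card_roots_eq_k_width: "card (roots F) = k_width k A"
  unfolding k_width_def
proof (rule Least_equality[symmetric])
  have "finite (tree_vertex_sets F)"
    using roots_subset finite_nodes by (auto simp: tree_vertex_sets_def intro: finite_subset)
  then show "\<exists>P. kary_chain_partition k A P \<and> finite P \<and> card P = card (roots F)"
    using tree_vertex_sets_kary_chain_partition card_tree_vertex_sets by blast
qed (use card_roots_le in auto)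

end

section \<open>Runs of the algorithm on sorted lists\<close>

lemma greedy_forest_empty: "greedy_forest k {} empty_forest"
  by unfold_locales (auto simp: empty_forest_def)

text \<open>Sortedness supplies what preservation asks of the next interval: it is new because
  \<open>sq_less\<close> is irreflexive, and its upper end is at least all earlier ones.\<close>

lemma greedy_forest_append_step:
  assumes "greedy_forest k (set xs) F" and "greedy_step k x F F'"
    and "sorted_wrt sq_less (xs @ [x])" and "proper_interval x"
  shows "greedy_forest k (set (xs @ [x])) F'"
proof -
  have less: "sq_less y x" if "y \<in> set xs" for y
    using assms(3) that by (simp add: sorted_wrt_append)
  have "greedy_forest k (insert x (set xs)) F'"
    using assms(1,2)
  proof (rule greedy_forest.greedy_step_greedy_forest)
    show "x \<notin> set xs" using less[of x] by (auto simp: sq_less_def)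
    show "upper y \<le> upper x" if "y \<in> set xs" for y
      using less[OF that] by (auto simp: sq_less_def)
  qed fact
  then show ?thesis by simp
qed

lemma greedy_run_greedy_forest:
  assumes "greedy_run k xs F" and "sorted_wrt sq_less xs" and "\<forall>x \<in> set xs. proper_interval x"
  shows "greedy_forest k (set xs) F"
  using assms
proof induction
  case start
  then show ?case by (simp add: greedy_forest_empty)
next
  case (step xs F x F')
  then have "greedy_forest k (set xs) F" by (simp add: sorted_wrt_append)
  then show ?case
    by (rule greedy_forest_append_step) (use step in auto)
qed

text \<open>A run never gets stuck: by the invariant the set of slots is finite, so either no slot
  is compatible or a compatible one of highest value exists.\<close>

lemma ex_greedy_run:
  assumes "sorted_wrt sq_less xs" and "\<forall>x \<in> set xs. proper_interval x"
  shows "\<exists>F. greedy_run k xs F"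
  using assms
proof (induction xs rule: rev_induct)
  case Nil
  then show ?case using greedy_run.start by blast
next
  case (snoc x xs)
  then have "sorted_wrt sq_less xs" "\<forall>x \<in> set xs. proper_interval x"
    by (auto simp: sorted_wrt_append)
  moreover from this obtain F where "greedy_run k xs F" using snoc.IH by blast
  ultimately show ?case
    using greedy_run_greedy_forest greedy_forest.ex_greedy_step greedy_run.step by blast
qed

theorem corollary4:
  fixes k :: nat and I :: "real interval set"
  assumes "k \<ge> 1" and "finite I" and "\<forall>x \<in> I. proper_interval x"
  shows "(\<exists>P. greedy_output k I P) \<and>
    (\<forall>P. greedy_output k I P \<longrightarrow> kary_chain_partition k I P \<and> card P = k_width k I)"
proof (intro conjI allI impI)
  show "\<exists>P. greedy_output k I P"
    using ex_sq_less_sorted_list[OF assms(2)] ex_greedy_run assms(3)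
    unfolding greedy_output_def by metis
next
  fix P assume "greedy_output k I P"
  then obtain F where "greedy_forest k I F" and P: "P = tree_vertex_sets F"
    using greedy_run_greedy_forest assms(3) unfolding greedy_output_def by blast
  then interpret greedy_forest k I F by simp
  show "kary_chain_partition k I P"
    unfolding P by (rule tree_vertex_sets_kary_chain_partition)
  show "card P = k_width k I"
    unfolding P by (simp add: card_tree_vertex_sets card_roots_eq_k_width)
qed

end
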